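(* Let $\mathcal{R}$ be a unital ring, let $n\geq 2$, let $M_n(\mathcal{R})$ be the ring of all $n\times n$ matrices over $\mathcal{R}$, let $\mathcal{M}$ be a $2$-torsion free $M_n(\mathcal{R})$-bimodule (not necessarily unital), and let $D:M_n(\mathcal{R})\rightarrow\mathcal{M}$ be an additive mapping. (i) If $D$ is a Jordan derivation, then $D$ is a derivation. (ii) If $D$ is a generalized Jordan derivation, then $D$ is a generalized derivation.
   Context: All rings are associative (not necessarily commutative). Let $\mathcal{A}$ be a unital ring and $\mathcal{M}$ an $\mathcal{A}$-bimodule; bimodules are not assumed unital, i.e. $1m=m$ and $m1=m$ are not required. $\mathcal{M}$ is $2$-torsion free if $2m=0$ implies $m=0$ for $m\in\mathcal{M}$. An additive map $D:\mathcal{A}\rightarrow\mathcal{M}$ is: - a Jordan derivation if $D(ab+ba)=D(a)b+aD(b)+D(b)a+bD(a)$ for all $a,b\in\mathcal{A}$; - a generalized Jordan derivation if $D(ab+ba)=D(a)b+aD(b)+D(b)a+bD(a)-aD(1)b-bD(1)a$ for all $a,b\in\mathcal{A}$; - a derivation if $D(ab)=D(a)b+aD(b)$ for all $a,b\in\mathcal{A}$; - a generalized derivation if $D(ab)=D(a)b+aD(b)-aD(1)b$ for all $a,b\in\mathcal{A}$. *)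

theory Defs
  imports "Jordan_Normal_Form.Matrix"
begin

text \<open>
  The library's \<^const>\<open>ring_mat\<close> needs coefficients of class \<^class>\<open>semiring_1\<close>, which excludes
  the zero ring. The sort \<open>{ring, monoid_mult}\<close> describes all associative unital rings,
  so the same record is introduced here for that sort.
\<close>

definition matrix_ring :: "'r::{ring,monoid_mult} itself \<Rightarrow> nat \<Rightarrow> 'r mat ring" where
  "matrix_ring _ n =
    \<lparr>carrier = carrier_mat n n, mult = (*), one = 1\<^sub>m n, zero = 0\<^sub>m n n, add = (+)\<rparr>"

lemma matrix_ring_simps [simp]:
  "carrier (matrix_ring ty n) = carrier_mat n n"
  "mult (matrix_ring ty n) = (*)"
  "one (matrix_ring ty n) = 1\<^sub>m n"
  "zero (matrix_ring ty n) = 0\<^sub>m n n"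
  "add (matrix_ring ty n) = (+)"
  by (simp_all add: matrix_ring_def)

lemma one_mat_mult_left:
  fixes A :: "'r::{ring,monoid_mult} mat"
  assumes "A \<in> carrier_mat n n"
  shows "1\<^sub>m n * A = A"
  using assms
  by (intro eq_matI) (auto simp: scalar_prod_def if_distrib[of "\<lambda>x. x * _"] cong: if_cong)

lemma one_mat_mult_right:
  fixes A :: "'r::{ring,monoid_mult} mat"
  assumes "A \<in> carrier_mat n n"
  shows "A * 1\<^sub>m n = A"
  using assms
  by (intro eq_matI) (auto simp: scalar_prod_def if_distrib[of "\<lambda>x. _ * x"] cong: if_cong)

lemma ring_matrix_ring: "ring (matrix_ring TYPE('r::{ring,monoid_mult}) n)"
proof -
  have "\<exists>B \<in> carrier_mat n n. B + A = 0\<^sub>m n n \<and> A + B = 0\<^sub>m n n"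
    if "A \<in> carrier_mat n n" for A :: "'r mat"
    using that by (intro bexI[of _ "- A"]) auto
  then show ?thesis
    by unfold_locales
      (auto simp: Units_def one_mat_mult_left one_mat_mult_right comm_add_mat
         assoc_mult_mat[of _ n n _ n _ n] add_mult_distrib_mat[of _ n n _ _ n]
         mult_add_distrib_mat[of _ n n _ n])
qed

text \<open>
  The underlying additive group of the bimodule is the type \<open>'m\<close>; the actions are only
  constrained on the carrier of \<open>A\<close>, and the unit of \<open>A\<close> need not act as the identity.
\<close>

locale bimodule = ring A for A (structure) +
  fixes lact :: "'a \<Rightarrow> 'm::ab_group_add \<Rightarrow> 'm"
    and ract :: "'m \<Rightarrow> 'a \<Rightarrow> 'm"
  assumes lact_add: "a \<in> carrier A \<Longrightarrow> lact a (x + y) = lact a x + lact a y"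
    and add_lact: "\<lbrakk>a \<in> carrier A; b \<in> carrier A\<rbrakk> \<Longrightarrow> lact (a \<oplus> b) x = lact a x + lact b x"
    and mult_lact: "\<lbrakk>a \<in> carrier A; b \<in> carrier A\<rbrakk> \<Longrightarrow> lact (a \<otimes> b) x = lact a (lact b x)"
    and add_ract: "a \<in> carrier A \<Longrightarrow> ract (x + y) a = ract x a + ract y a"
    and ract_add: "\<lbrakk>a \<in> carrier A; b \<in> carrier A\<rbrakk> \<Longrightarrow> ract x (a \<oplus> b) = ract x a + ract x b"
    and ract_mult: "\<lbrakk>a \<in> carrier A; b \<in> carrier A\<rbrakk> \<Longrightarrow> ract x (a \<otimes> b) = ract (ract x a) b"
    and lact_ract: "\<lbrakk>a \<in> carrier A; b \<in> carrier A\<rbrakk> \<Longrightarrow> ract (lact a x) b = lact a (ract x b)"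

definition two_torsion_free :: "'m::ab_group_add itself \<Rightarrow> bool" where
  "two_torsion_free _ \<longleftrightarrow> (\<forall>x::'m. x + x = 0 \<longrightarrow> x = 0)"

definition additive_map :: "('a, 'b) ring_scheme \<Rightarrow> ('a \<Rightarrow> 'm::ab_group_add) \<Rightarrow> bool" where
  "additive_map A D \<longleftrightarrow>
    (\<forall>a\<in>carrier A. \<forall>b\<in>carrier A. D (a \<oplus>\<^bsub>A\<^esub> b) = D a + D b)"

definition jordan_derivation ::
  "('a, 'b) ring_scheme \<Rightarrow> ('a \<Rightarrow> 'm \<Rightarrow> 'm) \<Rightarrow> ('m \<Rightarrow> 'a \<Rightarrow> 'm) \<Rightarrow> ('a \<Rightarrow> 'm::ab_group_add) \<Rightarrow> bool"
  where "jordan_derivation A lact ract D \<longleftrightarrow> additive_map A D \<and>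
    (\<forall>a\<in>carrier A. \<forall>b\<in>carrier A.
      D (a \<otimes>\<^bsub>A\<^esub> b \<oplus>\<^bsub>A\<^esub> b \<otimes>\<^bsub>A\<^esub> a) =
        ract (D a) b + lact a (D b) + ract (D b) a + lact b (D a))"

definition generalized_jordan_derivation ::
  "('a, 'b) ring_scheme \<Rightarrow> ('a \<Rightarrow> 'm \<Rightarrow> 'm) \<Rightarrow> ('m \<Rightarrow> 'a \<Rightarrow> 'm) \<Rightarrow> ('a \<Rightarrow> 'm::ab_group_add) \<Rightarrow> bool"
  where "generalized_jordan_derivation A lact ract D \<longleftrightarrow> additive_map A D \<and>
    (\<forall>a\<in>carrier A. \<forall>b\<in>carrier A.
      D (a \<otimes>\<^bsub>A\<^esub> b \<oplus>\<^bsub>A\<^esub> b \<otimes>\<^bsub>A\<^esub> a) =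
        ract (D a) b + lact a (D b) + ract (D b) a + lact b (D a)
          - ract (lact a (D \<one>\<^bsub>A\<^esub>)) b - ract (lact b (D \<one>\<^bsub>A\<^esub>)) a)"

definition derivation ::
  "('a, 'b) ring_scheme \<Rightarrow> ('a \<Rightarrow> 'm \<Rightarrow> 'm) \<Rightarrow> ('m \<Rightarrow> 'a \<Rightarrow> 'm) \<Rightarrow> ('a \<Rightarrow> 'm::ab_group_add) \<Rightarrow> bool"
  where "derivation A lact ract D \<longleftrightarrow> additive_map A D \<and>
    (\<forall>a\<in>carrier A. \<forall>b\<in>carrier A. D (a \<otimes>\<^bsub>A\<^esub> b) = ract (D a) b + lact a (D b))"

definition generalized_derivation ::
  "('a, 'b) ring_scheme \<Rightarrow> ('a \<Rightarrow> 'm \<Rightarrow> 'm) \<Rightarrow> ('m \<Rightarrow> 'a \<Rightarrow> 'm) \<Rightarrow> ('a \<Rightarrow> 'm::ab_group_add) \<Rightarrow> bool"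
  where "generalized_derivation A lact ract D \<longleftrightarrow> additive_map A D \<and>
    (\<forall>a\<in>carrier A. \<forall>b\<in>carrier A.
      D (a \<otimes>\<^bsub>A\<^esub> b) = ract (D a) b + lact a (D b) - ract (lact a (D \<one>\<^bsub>A\<^esub>)) b)"

end

theory Submission
  imports Defs
begin

text \<open>
  For an additive map \<open>D\<close> put \<open>J(a,b) = D(ab) - D(a)b - aD(b)\<close>, so that \<open>D\<close> is a derivation
  iff \<open>J = 0\<close>. Being a Hochschild coboundary, \<open>J\<close> satisfies the cocycle identity
  \<open>J(ab,c) + J(a,b)c = J(a,bc) + aJ(b,c)\<close>, and \<open>D\<close> is a Jordan derivation iff \<open>J\<close> is
  antisymmetric. Adding up cyclic permutations of the cocycle identity for an antisymmetric \<open>J\<close>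
  gives \<open>2J(ab,c) = [c,J(a,b)] + a \<circ> J(b,c) + b \<circ> J(a,c)\<close>, where \<open>u \<circ> v = uv + vu\<close> (lemma \<open>double_defect_mult\<close>). Three consequences carry the proof.

  \<^item> The radical of \<open>J\<close>, the set of \<open>a\<close> with \<open>J(a,c) = 0\<close> for all \<open>c\<close>, is a subring.
  \<^item> The part of the formula symmetric in \<open>a\<close> and \<open>b\<close> says that each \<open>J(-,c)\<close> is a Jordan
    derivation in the sense that \<open>J(a \<circ> b, c) = a \<circ> J(b,c) + b \<circ> J(a,c)\<close>.
  \<^item> The antisymmetric part is \<open>J([a,b],c) = [c,J(a,b)]\<close>. An element \<open>x = ex\<close> with \<open>xe = 0\<close> for an
    idempotent \<open>e\<close> equals \<open>[e,x]\<close>, so it lies in the radical as soon as \<open>J(e,x) = 0\<close>.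

  For orthogonal idempotents \<open>e, f\<close> and \<open>x = exf\<close>, these identities place \<open>J(e,x)\<close> in the opposite
  Peirce component \<open>f\<M>e\<close>. If moreover some \<open>z = ezf\<close> and \<open>t\<close> satisfy \<open>tz = f\<close>, then \<open>x \<circ> z = 0\<close>
  yields \<open>zJ(e,x) = 0\<close>, and multiplying by \<open>t\<close> gives \<open>J(e,x) = 0\<close> (lemma
  \<open>defect_peirce_corner\<close>). In a matrix ring this applies to \<open>e = e\<^sub>i\<^sub>i\<close>, \<open>f = e\<^sub>j\<^sub>j\<close>, \<open>z = e\<^sub>i\<^sub>j\<close>,
  \<open>t = e\<^sub>j\<^sub>i\<close>, so the radical contains every \<open>r e\<^sub>i\<^sub>j\<close> with \<open>i \<noteq> j\<close>; for \<open>n \<ge> 2\<close> these generate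
  the whole matrix ring, since \<open>r e\<^sub>i\<^sub>i = (r e\<^sub>i\<^sub>j) e\<^sub>j\<^sub>i\<close>.

  Non-unital bimodules are covered by the same argument, because an idempotent is cancelled only
  from elements that it has been shown to fix. Generalized Jordan derivations reduce to Jordan derivations by passing from \<open>D\<close> to
  \<open>a \<mapsto> D(a) - D(1)a\<close>.
\<close>

section \<open>Bimodules and the derivation defect\<close>

context bimodule
begin

lemma lact_zero [simp]: "a \<in> carrier A \<Longrightarrow> lact a 0 = 0"
  using lact_add[of a 0 0] by simp

lemma ract_zero [simp]: "a \<in> carrier A \<Longrightarrow> ract 0 a = 0"
  using add_ract[of a 0 0] by simp

lemma zero_lact [simp]: "lact \<zero> x = 0"
  using add_lact[of \<zero> \<zero> x] by simp

lemma zero_ract [simp]: "ract x \<zero> = 0"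
  using ract_add[of \<zero> \<zero> x] by simp

lemma lact_diff: "a \<in> carrier A \<Longrightarrow> lact a (x - y) = lact a x - lact a y"
  using lact_add[of a "x - y" y] by (simp add: algebra_simps)

lemma ract_diff: "a \<in> carrier A \<Longrightarrow> ract (x - y) a = ract x a - ract y a"
  using add_ract[of a "x - y" y] by (simp add: algebra_simps)

lemma lact_uminus: "a \<in> carrier A \<Longrightarrow> lact a (- x) = - lact a x"
  using lact_diff[of a 0 x] by simp

lemma ract_uminus: "a \<in> carrier A \<Longrightarrow> ract (- x) a = - ract x a"
  using ract_diff[of a 0 x] by simp

lemmas action_simps =
  lact_add ract_add add_lact add_ract lact_diff ract_diff lact_uminus ract_uminus

definition defect :: "('a \<Rightarrow> 'm) \<Rightarrow> 'a \<Rightarrow> 'a \<Rightarrow> 'm" where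
  "defect D a b = D (a \<otimes> b) - ract (D a) b - lact a (D b)"

end

locale torsion_free_jordan_derivation = bimodule A lact ract
  for A (structure) and lact :: "'a \<Rightarrow> 'm::ab_group_add \<Rightarrow> 'm" and ract +
  fixes D :: "'a \<Rightarrow> 'm"
  assumes torsion_free: "two_torsion_free TYPE('m)"
    and jordan: "jordan_derivation A lact ract D"
begin

abbreviation J where "J \<equiv> defect D"

lemma eq_zero_if_double: "x + x = 0 \<Longrightarrow> x = 0" for x :: 'm
  using torsion_free unfolding two_torsion_free_def by blast

lemma eq_if_double_eq: "x = y" if "x + x = y + y" for x y :: 'm
proof -
  have "(x - y) + (x - y) = (x + x) - (y + y)"
    by simp
  then have "(x - y) + (x - y) = 0"
    using that by simp
  then have "x - y = 0"
    by (rule eq_zero_if_double)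
  then show ?thesis
    by simp
qed

lemma D_add: "\<lbrakk>a \<in> carrier A; b \<in> carrier A\<rbrakk> \<Longrightarrow> D (a \<oplus> b) = D a + D b"
  using jordan by (auto simp: jordan_derivation_def additive_map_def)

lemma D_zero [simp]: "D \<zero> = 0"
  using D_add[of \<zero> \<zero>] by simp

lemma defect_zero_left [simp]: "a \<in> carrier A \<Longrightarrow> J \<zero> a = 0"
  by (simp add: defect_def)

lemma defect_zero_right [simp]: "a \<in> carrier A \<Longrightarrow> J a \<zero> = 0"
  by (simp add: defect_def)

lemma defect_add_left:
  "\<lbrakk>a \<in> carrier A; b \<in> carrier A; c \<in> carrier A\<rbrakk> \<Longrightarrow> J (a \<oplus> b) c = J a c + J b c"
  by (simp add: defect_def D_add l_distr action_simps)

lemma defect_antisym: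
  assumes "a \<in> carrier A" "b \<in> carrier A"
  shows "J a b = - J b a"
proof -
  have "D (a \<otimes> b) + D (b \<otimes> a) =
      ract (D a) b + lact a (D b) + ract (D b) a + lact b (D a)"
    using jordan assms D_add[of "a \<otimes> b" "b \<otimes> a"] by (simp add: jordan_derivation_def)
  moreover have "J a b + J b a = (D (a \<otimes> b) + D (b \<otimes> a))
      - (ract (D a) b + lact a (D b) + ract (D b) a + lact b (D a))"
    by (simp add: defect_def algebra_simps)
  ultimately have "J a b + J b a = 0"
    by simp
  then show ?thesis
    by (rule eq_neg_iff_add_eq_0[THEN iffD2])
qed

lemma defect_self [simp]: "a \<in> carrier A \<Longrightarrow> J a a = 0"
  using defect_antisym[of a a] eq_neg_iff_add_eq_0 eq_zero_if_double by blast

lemma defect_cocycle: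
  assumes "a \<in> carrier A" "b \<in> carrier A" "c \<in> carrier A"
  shows "J (a \<otimes> b) c + ract (J a b) c = J a (b \<otimes> c) + lact a (J b c)"
  using assms
  by (simp add: defect_def m_assoc action_simps mult_lact ract_mult lact_ract algebra_simps)

text \<open>
  By antisymmetry the cocycle identity expresses \<open>J(ab,c) + J(bc,a)\<close>. Of the three sums obtained
  by rotating \<open>a, b, c\<close>, the two containing \<open>J(ab,c)\<close> minus the third leave \<open>2J(ab,c)\<close>.
\<close>

lemma double_defect_mult:
  assumes "a \<in> carrier A" "b \<in> carrier A" "c \<in> carrier A"
  shows "J (a \<otimes> b) c + J (a \<otimes> b) c =
    lact c (J a b) - ract (J a b) c
      + (lact a (J b c) + ract (J b c) a) + (lact b (J a c) + ract (J a c) b)"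
proof -
  have rotated: "J (u \<otimes> v) w + J (v \<otimes> w) u = lact u (J v w) - ract (J u v) w"
    if "u \<in> carrier A" "v \<in> carrier A" "w \<in> carrier A" for u v w
    using defect_cocycle[OF that] defect_antisym[of u "v \<otimes> w"] that
    by (simp add: algebra_simps)
  have swap: "J c a = - J a c"
    using assms by (intro defect_antisym)
  have "J (a \<otimes> b) c + J (a \<otimes> b) c =
      (J (a \<otimes> b) c + J (b \<otimes> c) a) + (J (c \<otimes> a) b + J (a \<otimes> b) c)
        - (J (b \<otimes> c) a + J (c \<otimes> a) b)"
    by simp
  also have "\<dots> = (lact a (J b c) - ract (J a b) c) + (lact c (J a b) - ract (J c a) b)
      - (lact b (J c a) - ract (J b c) a)"
    using assms by (simp only: rotated)
  also have "\<dots> = lact c (J a b) - ract (J a b) c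
      + (lact a (J b c) + ract (J b c) a) + (lact b (J a c) + ract (J a c) b)"
    using assms by (simp add: swap lact_uminus ract_uminus algebra_simps)
  finally show ?thesis .
qed

text \<open>
  The next two lemmas are the parts of \<open>double_defect_mult\<close> that are symmetric and antisymmetric
  in \<open>a\<close> and \<open>b\<close>; \<open>2\<close> can be cancelled in both.
\<close>

lemma defect_jordan_left:
  assumes "a \<in> carrier A" "b \<in> carrier A" "c \<in> carrier A"
  shows "J (a \<otimes> b) c + J (b \<otimes> a) c = lact a (J b c) + ract (J b c) a + (lact b (J a c) + ract (J a c) b)"
    (is "?ab + ?ba = ?rhs")
proof (rule eq_if_double_eq)
  have swap: "J b a = - J a b"
    using assms by (intro defect_antisym)
  have "(?ab + ?ba) + (?ab + ?ba) = (?ab + ?ab) + (?ba + ?ba)"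
    by (simp only: algebra_simps)
  also have "\<dots> = ?rhs + ?rhs"
    unfolding double_defect_mult[OF assms] double_defect_mult[OF assms(2,1,3)] swap
    using assms by (simp add: lact_uminus ract_uminus)
  finally show "(?ab + ?ba) + (?ab + ?ba) = ?rhs + ?rhs" .
qed

lemma defect_commutator_left:
  assumes "a \<in> carrier A" "b \<in> carrier A" "c \<in> carrier A"
  shows "J (a \<otimes> b) c - J (b \<otimes> a) c = lact c (J a b) - ract (J a b) c"
    (is "?ab - ?ba = ?rhs")
proof (rule eq_if_double_eq)
  have swap: "J b a = - J a b"
    using assms by (intro defect_antisym)
  have "(?ab - ?ba) + (?ab - ?ba) = (?ab + ?ab) - (?ba + ?ba)"
    by (simp only: algebra_simps)
  also have "\<dots> = ?rhs + ?rhs"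
    unfolding double_defect_mult[OF assms] double_defect_mult[OF assms(2,1,3)] swap
    using assms by (simp add: lact_uminus ract_uminus)
  finally show "(?ab - ?ba) + (?ab - ?ba) = ?rhs + ?rhs" .
qed

section \<open>The radical and Peirce corners\<close>

definition radical :: "'a set" where
  "radical = {a \<in> carrier A. \<forall>c \<in> carrier A. J a c = 0}"

lemma radical_add: "\<lbrakk>a \<in> radical; b \<in> radical\<rbrakk> \<Longrightarrow> a \<oplus> b \<in> radical"
  by (auto simp: radical_def defect_add_left)

text \<open>Every term of \<open>double_defect_mult\<close> contains a value of \<open>J\<close> with \<open>a\<close> or \<open>b\<close> as first argument.\<close>

lemma radical_mult:
  assumes "a \<in> radical" "b \<in> radical"
  shows "a \<otimes> b \<in> radical"
proof -
  have "J (a \<otimes> b) c = 0" if "c \<in> carrier A" for c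
  proof (rule eq_zero_if_double)
    show "J (a \<otimes> b) c + J (a \<otimes> b) c = 0"
      using double_defect_mult[of a b c] assms that by (simp add: radical_def)
  qed
  with assms show ?thesis
    by (simp add: radical_def)
qed

text \<open>Here \<open>x = [e,x]\<close>, so \<open>defect_commutator_left\<close> applies.\<close>

lemma defect_off_diagonal:
  assumes "e \<in> carrier A" "x \<in> carrier A" "c \<in> carrier A"
    and "e \<otimes> x = x" "x \<otimes> e = \<zero>"
  shows "J x c = lact c (J e x) - ract (J e x) c"
  using defect_commutator_left[of e x c] assms by simp

lemma radical_if_off_diagonal:
  assumes "e \<in> carrier A" "x \<in> carrier A" "e \<otimes> x = x" "x \<otimes> e = \<zero>" "J e x = 0"
  shows "x \<in> radical"
  using assms defect_off_diagonal[of e x] by (simp add: radical_def)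

text \<open>
  With \<open>c = e\<close> in the previous formula, antisymmetry turns it into \<open>y = ye - ey\<close> for
  \<open>y = J(e,x)\<close>. Multiplying by \<open>e\<close> on both sides gives \<open>eye = 0\<close>, then multiplying by \<open>e\<close> on the
  left gives \<open>2ey = 0\<close>.
\<close>

lemma defect_idempotent_off_diagonal:
  assumes e: "e \<in> carrier A" and x: "x \<in> carrier A"
    and idem: "e \<otimes> e = e" and ex: "e \<otimes> x = x" "x \<otimes> e = \<zero>"
  shows "lact e (J e x) = 0" "ract (J e x) e = J e x"
proof -
  define y where "y = J e x"
  have "y = - J x e"
    unfolding y_def using e x by (rule defect_antisym)
  also have "\<dots> = ract y e - lact e y"
    unfolding defect_off_diagonal[OF e x e ex] y_def by simp
  finally have y: "y = ract y e - lact e y" .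
  have ee: "lact e (lact e u) = lact e u" "ract (ract u e) e = ract u e" for u
    using mult_lact[OF e e, of u] ract_mult[OF e e, of u] idem by simp_all
  have "lact e y = lact e (ract y e - lact e y)"
    using y by (rule arg_cong)
  also have "\<dots> = lact e (ract y e) - lact e y"
    by (simp only: lact_diff e ee)
  finally have left: "lact e y = lact e (ract y e) - lact e y" .
  have "ract (lact e y) e = ract (lact e (ract y e) - lact e y) e"
    using left by (rule arg_cong)
  also have "\<dots> = 0"
    by (simp add: ract_diff lact_ract e ee)
  finally have "lact e (ract y e) = 0"
    by (simp only: lact_ract e)
  with left have "lact e y = - lact e y"
    by (simp only: diff_0)
  then have ey: "lact e y = 0"
    by (intro eq_zero_if_double[OF eq_neg_iff_add_eq_0[THEN iffD1]])
  then show "lact e (J e x) = 0"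
    by (simp only: y_def)
  have "ract y e = y"
    using y unfolding ey by simp
  then show "ract (J e x) e = J e x"
    by (simp only: y_def)
qed

text \<open>
  The cocycle identity at \<open>(e,e,f)\<close> shows that \<open>J(e,f)\<close> is fixed by left multiplication with
  \<open>e\<close>; by antisymmetry it is fixed by \<open>f\<close> as well, while \<open>ef = 0\<close>.
\<close>

lemma defect_orthogonal_idempotents:
  assumes e: "e \<in> carrier A" "e \<otimes> e = e" and f: "f \<in> carrier A" "f \<otimes> f = f"
    and ef: "e \<otimes> f = \<zero>" "f \<otimes> e = \<zero>"
  shows "J e f = 0"
proof -
  have stable: "J u v = lact u (J u v)"
    if "u \<in> carrier A" "u \<otimes> u = u" "v \<in> carrier A" "u \<otimes> v = \<zero>" for u v
    using defect_cocycle[of u u v] that by simp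
  have "J e f = lact e (J e f)"
    using e f ef by (intro stable)
  moreover have "J e f = lact f (J e f)"
  proof -
    have "J f e = - J e f"
      using f(1) e(1) by (rule defect_antisym)
    then show ?thesis
      using stable[OF f e(1) ef(2)] f(1) by (simp only: lact_uminus neg_equal_iff_equal)
  qed
  moreover have "lact e (lact f (J e f)) = 0"
    using mult_lact[of e f "J e f"] assms by simp
  ultimately show ?thesis by metis
qed

end

text \<open>
  An element \<open>x\<close> of the corner \<open>eAf\<close> is the commutator \<open>[e,x]\<close>, and products of two such elements
  vanish. In a matrix ring with \<open>e = e\<^sub>i\<^sub>i\<close> and \<open>f = e\<^sub>j\<^sub>j\<close>, the corner is the set of matrices
  supported at the position \<open>(i,j)\<close>.
\<close>

locale peirce_corner = torsion_free_jordan_derivation +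
  fixes e f
  assumes e: "e \<in> carrier A" "e \<otimes> e = e" and f: "f \<in> carrier A" "f \<otimes> f = f"
    and ef: "e \<otimes> f = \<zero>" "f \<otimes> e = \<zero>"
begin

definition corner :: "'a set" where
  "corner = {x \<in> carrier A. e \<otimes> x = x \<and> x \<otimes> f = x}"

lemma corner_carrier: "x \<in> corner \<Longrightarrow> x \<in> carrier A"
  and corner_left: "x \<in> corner \<Longrightarrow> e \<otimes> x = x"
  and corner_right: "x \<in> corner \<Longrightarrow> x \<otimes> f = x"
  by (auto simp: corner_def)

lemma corner_right_zero: "x \<in> corner \<Longrightarrow> x \<otimes> e = \<zero>"
  using m_assoc[of x f e] e f ef by (auto simp: corner_def)

lemma corner_left_zero: "x \<in> corner \<Longrightarrow> f \<otimes> x = \<zero>"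
  using m_assoc[of f e x] e f ef by (auto simp: corner_def)

lemma corner_mult_zero: "\<lbrakk>x \<in> corner; z \<in> corner\<rbrakk> \<Longrightarrow> x \<otimes> z = \<zero>"
  using m_assoc[of x e z] corner_right_zero[of x] e by (simp add: corner_def)

lemma defect_corner_right: "x \<in> corner \<Longrightarrow> ract (J e x) e = J e x"
  and defect_corner_left_zero: "x \<in> corner \<Longrightarrow> lact e (J e x) = 0"
  using defect_idempotent_off_diagonal[of e x] corner_carrier corner_left corner_right_zero e
  by auto

text \<open>
  Since \<open>x \<circ> f = x\<close> and \<open>J(e,f) = 0\<close>, the Jordan rule gives \<open>J(e,x) = f \<circ> J(e,x)\<close>; the summand
  \<open>J(e,x)f\<close> vanishes because \<open>J(e,x) = J(e,x)e\<close>.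
\<close>

lemma defect_corner_left:
  assumes x: "x \<in> corner"
  shows "lact f (J e x) = J e x"
proof -
  have "ract (J e x) f = ract (ract (J e x) e) f"
    using x by (simp add: defect_corner_right)
  also have "\<dots> = 0"
    using ract_mult[of e f "J e x"] e f ef by simp
  finally have right: "ract (J e x) f = 0" .
  have "J f e = 0"
    using defect_orthogonal_idempotents[OF f e] ef by simp
  then have "J x e = lact f (J x e) + ract (J x e) f"
    using defect_jordan_left[of x f e] x e f
    by (simp add: corner_carrier corner_right corner_left_zero)
  then show ?thesis
    using defect_antisym[of x e] right x e f
    by (simp add: corner_carrier lact_uminus ract_uminus)
qed

text \<open>
  The Jordan rule for \<open>x \<circ> z = 0\<close> has four terms, two in the component \<open>e\<M>e\<close> and two in
  \<open>f\<M>f\<close>; this is its \<open>e\<M>e\<close> part.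
\<close>

lemma defect_corner_exchange:
  assumes x: "x \<in> corner" and z: "z \<in> corner"
  shows "lact x (J e z) + lact z (J e x) = 0"
proof -
  have left: "lact e (lact u m) = lact u m" if "u \<in> corner" for u m
    using mult_lact[of e u m] that e by (simp add: corner_carrier corner_left)
  have right: "lact e (ract (J e u) v) = 0" if "u \<in> corner" "v \<in> corner" for u v
    using lact_ract[of e v "J e u"] that e by (simp add: corner_carrier defect_corner_left_zero)
  have swap: "J u e = - J e u" if "u \<in> corner" for u
    using that e by (intro defect_antisym) (auto simp: corner_carrier)
  have "0 = lact x (J z e) + ract (J z e) x + (lact z (J x e) + ract (J x e) z)"
    using defect_jordan_left[of x z e] x z e by (simp add: corner_carrier corner_mult_zero)
  then have "lact e 0 = lact e (lact x (J z e) + ract (J z e) x + (lact z (J x e) + ract (J x e) z))"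
    by simp
  then show ?thesis
    using x z e
    by (simp add: swap corner_carrier lact_uminus ract_uminus lact_add lact_diff left right)
       (metis add.commute neg_eq_iff_add_eq_0)
qed

text \<open>
  Existence of \<open>z\<close> and \<open>t\<close> means that left multiplication by \<open>z\<close> is injective on \<open>f\<M>\<close>. The
  exchange identity first yields \<open>2zJ(e,z) = 0\<close>, which kills \<open>J(e,z)\<close>, and then \<open>zJ(e,x) = 0\<close>.
\<close>

lemma defect_peirce_corner:
  assumes x: "x \<in> corner" and z: "z \<in> corner" and t: "t \<in> carrier A" "t \<otimes> z = f"
  shows "J e x = 0"
proof -
  have cancel: "J e u = 0" if "lact z (J e u) = 0" "u \<in> corner" for u
    using mult_lact[of t z "J e u"] that z t by (simp add: corner_carrier defect_corner_left)
  have "lact z (J e z) = 0"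
    using defect_corner_exchange[OF z z] by (rule eq_zero_if_double)
  then have "J e z = 0"
    using z by (rule cancel)
  then have "lact z (J e x) = 0"
    using defect_corner_exchange[OF x z] x by (simp add: corner_carrier)
  then show ?thesis
    using x by (rule cancel)
qed

lemma corner_subset_radical:
  assumes "z \<in> corner" "t \<in> carrier A" "t \<otimes> z = f"
  shows "corner \<subseteq> radical"
  using assms e
  by (auto intro!: radical_if_off_diagonal[of e] defect_peirce_corner[of _ z t]
      simp: corner_carrier corner_left corner_right_zero)

end

section \<open>Matrix rings\<close>

definition elem_mat :: "nat \<Rightarrow> nat \<Rightarrow> nat \<Rightarrow> 'r::zero \<Rightarrow> 'r mat" where
  "elem_mat n i j r = mat n n (\<lambda>(k, l). if k = i \<and> l = j then r else 0)"

lemma elem_mat_carrier [simp]: "elem_mat n i j r \<in> carrier_mat n n"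
  by (simp add: elem_mat_def)

lemma elem_mat_mult:
  fixes r s :: "'r::{ring,monoid_mult}"
  assumes "j < n"
  shows "elem_mat n i j r * elem_mat n k l s = (if j = k then elem_mat n i l (r * s) else 0\<^sub>m n n)"
proof -
  have "(\<Sum>p = 0..<n. (if a = i \<and> p = j then r else 0) * (if p = k \<and> b = l then s else 0)) =
      (if a = i \<and> j = k \<and> b = l then r * s else 0)" for a b
  proof -
    have "(\<Sum>p = 0..<n. (if a = i \<and> p = j then r else 0) * (if p = k \<and> b = l then s else 0)) =
        (\<Sum>p = 0..<n. if p = j then (if a = i \<and> j = k \<and> b = l then r * s else 0) else 0)"
      by (intro sum.cong) auto
    then show ?thesis
      using assms by simp
  qed
  then show ?thesis
    by (intro eq_matI) (auto simp: elem_mat_def scalar_prod_def)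
qed

text \<open>The induction is on the set \<open>P\<close> of positions at which the entries of \<open>a\<close> are retained.\<close>

lemma mat_additively_generated_by_elem_mat:
  fixes a :: "'r::{ring,monoid_mult} mat"
  assumes a: "a \<in> carrier_mat n n"
    and zero: "0\<^sub>m n n \<in> S"
    and add: "\<And>u v. \<lbrakk>u \<in> S; v \<in> S\<rbrakk> \<Longrightarrow> u + v \<in> S"
    and elem: "\<And>i j r. \<lbrakk>i < n; j < n\<rbrakk> \<Longrightarrow> elem_mat n i j r \<in> S"
  shows "a \<in> S"
proof -
  have partial: "mat n n (\<lambda>p. if p \<in> P then a $$ p else 0) \<in> S"
    if "finite P" "P \<subseteq> {..<n} \<times> {..<n}" for P
    using that
  proof (induction P rule: finite_induct)
    case empty
    have "mat n n (\<lambda>p. if p \<in> {} then a $$ p else 0) = 0\<^sub>m n n"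
      by (intro eq_matI) auto
    with zero show ?case by simp
  next
    case (insert q P)
    obtain i j where q: "q = (i, j)" by force
    have "mat n n (\<lambda>p. if p \<in> insert q P then a $$ p else 0) =
        mat n n (\<lambda>p. if p \<in> P then a $$ p else 0) + elem_mat n i j (a $$ q)"
      using insert.hyps by (intro eq_matI) (auto simp: elem_mat_def q)
    with insert show ?case
      by (auto simp: q intro!: add elem)
  qed
  have "a = mat n n (\<lambda>p. if p \<in> {..<n} \<times> {..<n} then a $$ p else 0)"
    using a by (intro eq_matI) auto
  with partial[of "{..<n} \<times> {..<n}"] show ?thesis by simp
qed

lemma jordan_derivation_matrix_ring_imp_derivation:
  fixes D :: "'r::{ring,monoid_mult} mat \<Rightarrow> 'm::ab_group_add"
  assumes n: "n \<ge> 2"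
    and bimod: "bimodule (matrix_ring TYPE('r) n) lact ract"
    and tf: "two_torsion_free TYPE('m)"
    and D: "jordan_derivation (matrix_ring TYPE('r) n) lact ract D"
  shows "derivation (matrix_ring TYPE('r) n) lact ract D"
proof -
  interpret bimodule "matrix_ring TYPE('r) n" lact ract by (rule bimod)
  interpret torsion_free_jordan_derivation "matrix_ring TYPE('r) n" lact ract D
    using tf D by unfold_locales
  have off_diagonal: "elem_mat n i j r \<in> radical" if ij: "i < n" "j < n" "i \<noteq> j" for i j r
  proof -
    interpret peirce_corner "matrix_ring TYPE('r) n" lact ract D "elem_mat n i i 1" "elem_mat n j j 1"
      using ij by unfold_locales (auto simp: elem_mat_mult)
    have corner: "elem_mat n i j s \<in> corner" for s
      using ij by (simp add: corner_def elem_mat_mult)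
    have "corner \<subseteq> radical"
      using ij by (intro corner_subset_radical[OF corner[of 1], of "elem_mat n j i 1"])
        (auto simp: elem_mat_mult)
    with corner show ?thesis by blast
  qed
  have elem: "elem_mat n i j r \<in> radical" if ij: "i < n" "j < n" for i j r
  proof (cases "i = j")
    case True
    \<comment> \<open>An index other than \<open>i\<close> exists because \<open>n \<ge> 2\<close>.\<close>
    define k :: nat where "k = (if i = 0 then 1 else 0)"
    have k: "k < n" "k \<noteq> i"
      using n by (auto simp: k_def)
    have "elem_mat n i k r * elem_mat n k i 1 \<in> radical"
      using radical_mult[OF off_diagonal[of i k r] off_diagonal[of k i 1]] k ij by simp
    then show ?thesis
      using True k by (simp add: elem_mat_mult)
  qed (use ij off_diagonal in auto)
  have "a \<in> radical" if "a \<in> carrier_mat n n" for a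
    using that
  proof (rule mat_additively_generated_by_elem_mat)
    show "0\<^sub>m n n \<in> radical"
      using defect_zero_left by (simp add: radical_def)
    show "u + v \<in> radical" if "u \<in> radical" "v \<in> radical" for u v
      using radical_add[OF that] by simp
  qed (rule elem)
  then show ?thesis
    using D by (auto simp: derivation_def jordan_derivation_def radical_def defect_def algebra_simps)
qed

section \<open>Generalized Jordan derivations\<close>

context bimodule
begin

lemma additive_map_diff_unit:
  "additive_map A D \<Longrightarrow> additive_map A (\<lambda>a. D a - ract (D \<one>) a)"
  by (auto simp: additive_map_def ract_add)

text \<open>
  Subtracting the right action on \<open>D(1)\<close> replaces \<open>aD(b)\<close> by \<open>aD(b) - aD(1)b\<close>, which absorbs the
  correction terms of a generalized (Jordan) derivation, and replaces \<open>D(a)b\<close> by \<open>D(a)b - D(1)ab\<close>,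
  which is matched by the same change of \<open>D(ab)\<close> on the other side.
\<close>

lemma jordan_derivation_diff_unit:
  assumes "generalized_jordan_derivation A lact ract D"
  shows "jordan_derivation A lact ract (\<lambda>a. D a - ract (D \<one>) a)"
  using assms additive_map_diff_unit[of D]
  by (simp add: generalized_jordan_derivation_def jordan_derivation_def action_simps ract_mult
      lact_ract algebra_simps)

lemma generalized_derivation_if_diff_unit:
  assumes "additive_map A D"
    and "derivation A lact ract (\<lambda>a. D a - ract (D \<one>) a)"
  shows "generalized_derivation A lact ract D"
  using assms
  by (auto simp: generalized_derivation_def derivation_def action_simps ract_mult
      lact_ract algebra_simps)

end

theorem theorem3p2:
  fixes n :: nat
    and lact :: "'r::{ring,monoid_mult} mat \<Rightarrow> 'm::ab_group_add \<Rightarrow> 'm"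
    and ract :: "'m \<Rightarrow> 'r mat \<Rightarrow> 'm"
    and D :: "'r mat \<Rightarrow> 'm"
  assumes "n \<ge> 2"
    and "bimodule (matrix_ring TYPE('r) n) lact ract"
    and "two_torsion_free TYPE('m)"
    and "additive_map (matrix_ring TYPE('r) n) D"
  shows "(jordan_derivation (matrix_ring TYPE('r) n) lact ract D \<longrightarrow>
            derivation (matrix_ring TYPE('r) n) lact ract D) \<and>
         (generalized_jordan_derivation (matrix_ring TYPE('r) n) lact ract D \<longrightarrow>
            generalized_derivation (matrix_ring TYPE('r) n) lact ract D)"
proof (intro conjI impI)
  assume "jordan_derivation (matrix_ring TYPE('r) n) lact ract D"
  with assms show "derivation (matrix_ring TYPE('r) n) lact ract D"
    by (intro jordan_derivation_matrix_ring_imp_derivation)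
next
  assume gen: "generalized_jordan_derivation (matrix_ring TYPE('r) n) lact ract D"
  show "generalized_derivation (matrix_ring TYPE('r) n) lact ract D"
    using assms(2,4)
  proof (rule bimodule.generalized_derivation_if_diff_unit)
    show "derivation (matrix_ring TYPE('r) n) lact ract
        (\<lambda>a. D a - ract (D \<one>\<^bsub>matrix_ring TYPE('r) n\<^esub>) a)"
      using assms(1-3) bimodule.jordan_derivation_diff_unit[OF assms(2) gen]
      by (rule jordan_derivation_matrix_ring_imp_derivation)
  qed
qed

end
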